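(* Suppose that the constants $\alpha>\beta>0$ satisfy $\sqrt{\alpha}-\sqrt{\beta}>\sqrt{2}$ and let $\gamma>0$ be such that $$\frac{(\sqrt{\alpha}-\sqrt{\beta})^2}{2}-\frac{\gamma(\log\alpha-\log\beta)}{2}-1>0.$$ Let $A$ be the adjacency matrix of a random graph generated according to the binary symmetric stochastic block model with parameters $(n,p,q)$ and label $x^*$, where $p=\alpha\log n/n$ and $q=\beta\log n/n$. Then the following statement holds with probability at least $1-n^{-\Omega(1)}$: for all $x\in\mathcal{F}$ such that $\|x-x^*\|_2\le\sqrt{2\gamma\log n}$, one has $$\mathcal{P}(Ax)=\{x^*\}.$$
   Context: **Model.** $n\ge 2$ is an even integer, $\log$ is the natural logarithm, $p,q\in[0,1]$, $p>q$, and $x^*\in\{-1,+1\}^n$ is a label vector with $\mathbf{1}^Tx^*=0$, where $\mathbf{1}$ is the all-one vector. A random graph on vertex set $[n]=\{1,\dots,n\}$ is generated according to the binary symmetric stochastic block model with parameters $(n,p,q)$ and label $x^*$ if the entries $\{a_{ij}\}_{1\le i\le j\le n}$ of its (symmetric) adjacency matrix $A$ are independent with $a_{ij}\sim\mathrm{Bern}(p)$ if $x_i^*x_j^*=1$ and $a_{ij}\sim\mathrm{Bern}(q)$ if $x_i^*x_j^*=-1$ (self-loops allowed). **Projection.** $\mathcal{F}=\{x\in\mathbb{R}^n:\mathbf{1}^Tx=0,\ x_i\in\{\pm1\}\ \forall i\in[n]\}$, and for $c\in\mathbb{R}^n$, $\mathcal{P}(c)$ denotes the set of minimizers of $\|u-c\|_2^2$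 over $u\in\mathcal{F}$. **Convention.** "Probability at least $1-n^{-\Omega(1)}$" means probability at least $1-n^{-c}$ for all sufficiently large $n$, for some constant $c>0$ independent of $n$. *)

theory Defs
  imports "HOL-Probability.Probability"
begin

text \<open>
  Vectors of \<open>\<real>\<^sup>n\<close> are extensional functions on the index set \<open>{1..n}\<close>, so that equality of
  functions is equality of vectors. The Euclidean norm of \<open>x\<close> is \<open>L2_set x {1..n}\<close>.
\<close>

abbreviation Rvec :: "nat \<Rightarrow> (nat \<Rightarrow> real) set" where
  "Rvec n \<equiv> {1..n} \<rightarrow>\<^sub>E UNIV"

definition dist2 :: "nat \<Rightarrow> (nat \<Rightarrow> real) \<Rightarrow> (nat \<Rightarrow> real) \<Rightarrow> real" where
  "dist2 n x y = L2_set (\<lambda>i. x i - y i) {1..n}"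

definition mat_vec :: "nat \<Rightarrow> (nat \<Rightarrow> nat \<Rightarrow> real) \<Rightarrow> (nat \<Rightarrow> real) \<Rightarrow> (nat \<Rightarrow> real)" where
  "mat_vec n A x = (\<lambda>i\<in>{1..n}. \<Sum>j\<in>{1..n}. A i j * x j)"

definition balanced_labels :: "nat \<Rightarrow> (nat \<Rightarrow> real) set" where
  "balanced_labels n = {x \<in> Rvec n. (\<Sum>i\<in>{1..n}. x i) = 0 \<and> (\<forall>i\<in>{1..n}. x i \<in> {1, -1})}"

definition proj_labels :: "nat \<Rightarrow> (nat \<Rightarrow> real) \<Rightarrow> (nat \<Rightarrow> real) set" where
  "proj_labels n c = {u. is_arg_min (\<lambda>u. (dist2 n u c)\<^sup>2) (\<lambda>u. u \<in> balanced_labels n) u}"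

text \<open>
  The Bernoulli distribution as a measure on \<open>\<real>\<close> carried by \<open>{0, 1}\<close>. Note that
  \<open>bernoulli_pmf r\<close> clamps \<open>r\<close> to \<open>[0, 1]\<close>; the locale below restricts its parameters accordingly.
\<close>

definition Bern :: "real \<Rightarrow> real measure" where
  "Bern r = distr (measure_pmf (bernoulli_pmf r)) borel of_bool"

text \<open>
  \<open>A \<omega> i j\<close> is the entry at \<open>(i, j)\<close> of the adjacency matrix for the outcome \<open>\<omega>\<close>, relevant
  only for \<open>i, j \<in> {1..n}\<close>. The index set of the independent family contains the diagonal, i.e.
  self-loops are allowed. That the entries are 0 or 1 (almost surely) is part of their
  distribution being \<open>Bern\<close>.
\<close>

locale binary_symmetric_sbm = prob_space M for M :: "'w measure" +
  fixes n :: nat and p q :: real and xs :: "nat \<Rightarrow> real" and A :: "'w \<Rightarrow> nat \<Rightarrow> nat \<Rightarrow> real"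
  assumes n_ge_2: "n \<ge> 2" and even_n: "even n"
    and p_range: "p \<in> {0..1}" and q_range: "q \<in> {0..1}" and q_less_p: "q < p"
    and label: "xs \<in> balanced_labels n"
    and symmetric: "\<And>\<omega> i j. \<omega> \<in> space M \<Longrightarrow> i \<in> {1..n} \<Longrightarrow> j \<in> {1..n} \<Longrightarrow> A \<omega> i j = A \<omega> j i"
    and indep: "indep_vars (\<lambda>_. borel) (\<lambda>(i, j) \<omega>. A \<omega> i j) {(i, j). 1 \<le> i \<and> i \<le> j \<and> j \<le> n}"
    and same: "\<And>i j. 1 \<le> i \<Longrightarrow> i \<le> j \<Longrightarrow> j \<le> n \<Longrightarrow> xs i * xs j = 1 \<Longrightarrow>
      distr M borel (\<lambda>\<omega>. A \<omega> i j) = Bern p"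
    and different: "\<And>i j. 1 \<le> i \<Longrightarrow> i \<le> j \<Longrightarrow> j \<le> n \<Longrightarrow> xs i * xs j = -1 \<Longrightarrow>
      distr M borel (\<lambda>\<omega>. A \<omega> i j) = Bern q"

end

theory Submission
  imports Defs
begin

text \<open>
  For a label vector within distance \<open>\<surd>(2 t)\<close> of \<open>x\<^sup>*\<close>, replacing \<open>x\<^sup>*\<close> by \<open>x\<close> changes every
  entry of \<open>A x\<^sup>*\<close> by at most \<open>t\<close>, because the entries of \<open>A\<close> are 0 or 1 and each disagreement
  contributes 4 to the squared distance but only 2 to the entry. Hence no union bound over \<open>x\<close> is
  needed: it suffices that \<open>x\<^sup>*\<^sub>i (A x\<^sup>*)\<^sub>i > t = \<gamma> log n\<close> for all \<open>i\<close>, since then \<open>A x\<close> has the signs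
  of \<open>x\<^sup>*\<close>. For a single \<open>i\<close> this fails with probability at most \<open>n powr (- 1 - c)\<close>, by the Chernoff
  bound with parameter \<open>log (\<alpha> / \<beta>) / 2\<close>, where \<open>c\<close> is the quantity assumed to be positive.
\<close>

section \<open>Balanced labels, projection and robustness of signs\<close>

lemma balanced_labelsD:
  assumes "x \<in> balanced_labels n"
  shows "(\<Sum>i\<in>{1..n}. x i) = 0" and "i \<in> {1..n} \<Longrightarrow> x i = 1 \<or> x i = -1"
  using assms by (auto simp: balanced_labels_def)

lemma finite_balanced_labels: "finite (balanced_labels n)"
proof (rule finite_subset)
  show "balanced_labels n \<subseteq> {1..n} \<rightarrow>\<^sub>E {1, -1}"
    by (auto simp: balanced_labels_def PiE_iff extensional_def)
qed (auto intro: finite_PiE)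

lemma dist2_squared: "(dist2 n x y)\<^sup>2 = (\<Sum>i\<in>{1..n}. (x i - y i)\<^sup>2)"
  by (simp add: dist2_def L2_set_def sum_nonneg)

text \<open>Trades an equality of sets for strict comparisons of distances with a fixed label. The
  right-hand side ranges over a finite set, which later also gives measurability of the recovery
  event.\<close>

lemma proj_labels_eq_singleton_iff:
  assumes "xs \<in> balanced_labels n"
  shows "proj_labels n c = {xs} \<longleftrightarrow>
    (\<forall>u\<in>balanced_labels n - {xs}. (dist2 n xs c)\<^sup>2 < (dist2 n u c)\<^sup>2)"
  (is "?P \<longleftrightarrow> ?Q")
proof
  assume P: ?P
  then have min: "(dist2 n xs c)\<^sup>2 \<le> (dist2 n v c)\<^sup>2" if "v \<in> balanced_labels n" for v
    using that by (auto simp: proj_labels_def is_arg_min_linorder)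
  show ?Q
  proof (intro ballI, rule ccontr)
    fix u assume u: "u \<in> balanced_labels n - {xs}" and "\<not> (dist2 n xs c)\<^sup>2 < (dist2 n u c)\<^sup>2"
    then have "u \<in> proj_labels n c"
      using min by (force simp: proj_labels_def is_arg_min_linorder)
    with P u show False by auto
  qed
next
  assume Q: ?Q
  show ?P
  proof (intro equalityI subsetI)
    fix u assume "u \<in> proj_labels n c"
    with Q assms show "u \<in> {xs}" by (auto simp: proj_labels_def is_arg_min_def)
  next
    have "(dist2 n xs c)\<^sup>2 \<le> (dist2 n v c)\<^sup>2" if "v \<in> balanced_labels n" for v
      using Q that by (cases "v = xs") (auto intro: less_imp_le)
    moreover fix u assume "u \<in> {xs}"
    ultimately show "u \<in> proj_labels n c"
      using assms by (auto simp: proj_labels_def is_arg_min_linorder)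
  qed
qed

text \<open>The squared distance splits over coordinates, and the sign of \<open>c i\<close> is the
  best choice in each of them. The sign vector is \<open>xs\<close>, which is itself balanced, so
  the sum constraint does not interfere.\<close>

lemma proj_labels_eq_singletonI:
  assumes xs: "xs \<in> balanced_labels n" and pos: "\<And>i. i \<in> {1..n} \<Longrightarrow> 0 < xs i * c i"
  shows "proj_labels n c = {xs}"
  unfolding proj_labels_eq_singleton_iff[OF xs]
proof
  fix u assume u: "u \<in> balanced_labels n - {xs}"
  \<comment> \<open>Here \<open>u i = - xs i\<close>, so the right side exceeds the left by
    \<open>4 * xs i * c i\<close>.\<close>
  have less: "(xs i - c i)\<^sup>2 < (u i - c i)\<^sup>2" if i: "i \<in> {1..n}" "u i \<noteq> xs i" for i
    using balanced_labelsD(2)[OF xs i(1)] balanced_labelsD(2)[of u n i] u pos[OF i(1)] i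
    by (auto simp: power2_eq_square algebra_simps)
  \<comment> \<open>Both vectors are extensional, so they can only differ at an index in
    \<open>{1..n}\<close>.\<close>
  have differ: "\<exists>i\<in>{1..n}. u i \<noteq> xs i"
  proof (rule ccontr)
    assume "\<not> ?thesis"
    then have "u = xs"
      using u xs by (intro PiE_ext[of u "{1..n}" "\<lambda>_. UNIV" xs]) (auto simp: balanced_labels_def)
    with u show False by simp
  qed
  show "(dist2 n xs c)\<^sup>2 < (dist2 n u c)\<^sup>2"
    unfolding dist2_squared
  proof (rule sum_strict_mono_ex1)
    show "\<forall>i\<in>{1..n}. (xs i - c i)\<^sup>2 \<le> (u i - c i)\<^sup>2"
    proof
      fix i assume "i \<in> {1..n}"
      with less[of i] show "(xs i - c i)\<^sup>2 \<le> (u i - c i)\<^sup>2"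
        by (cases "u i = xs i") auto
    qed
    show "\<exists>i\<in>{1..n}. (xs i - c i)\<^sup>2 < (u i - c i)\<^sup>2"
      using differ less by blast
  qed simp
qed

lemma mat_vec_sign_robust:
  assumes xs: "xs \<in> balanced_labels n" and x: "x \<in> balanced_labels n"
    and t: "0 \<le> t" and close: "dist2 n x xs \<le> sqrt (2 * t)"
    and i: "i \<in> {1..n}" and a: "\<And>j. j \<in> {1..n} \<Longrightarrow> a i j = 0 \<or> a i j = 1"
    and margin: "t < (\<Sum>j\<in>{1..n}. xs i * xs j * a i j)"
  shows "0 < xs i * mat_vec n a x i"
proof -
  have "(\<Sum>j\<in>{1..n}. xs i * xs j * a i j) - xs i * mat_vec n a x i
      = (\<Sum>j\<in>{1..n}. xs i * a i j * (xs j - x j))"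
    using i by (simp add: mat_vec_def sum_distrib_left sum_subtractf[symmetric] algebra_simps)
  also have "\<dots> \<le> (\<Sum>j\<in>{1..n}. (x j - xs j)\<^sup>2 / 2)"
  proof (rule sum_mono)
    fix j assume j: "j \<in> {1..n}"
    \<comment> \<open>If \<open>x j = xs j\<close>, both sides are 0. Otherwise
      \<open>xs j - x j\<close> is 2 or -2, so the left side is at most 2, and the right side equals
      2.\<close>
    show "xs i * a i j * (xs j - x j) \<le> (x j - xs j)\<^sup>2 / 2"
      using a[OF j] balanced_labelsD(2)[OF xs i] balanced_labelsD(2)[OF xs j]
        balanced_labelsD(2)[OF x j]
      by auto
  qed
  also have "\<dots> = (dist2 n x xs)\<^sup>2 / 2"
    by (simp add: dist2_squared sum_divide_distrib)
  also have "\<dots> \<le> (sqrt (2 * t))\<^sup>2 / 2"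
    using close by (intro divide_right_mono power_mono) (auto simp: dist2_def)
  also have "\<dots> = t" using t by simp
  finally show ?thesis using margin by simp
qed

section \<open>Exponential moments and support of the Bernoulli law\<close>

lemma Bern_mgf:
  assumes "r \<in> {0..1}"
  shows "(\<integral>y. exp (s * y) \<partial>Bern r) = 1 + r * (exp s - 1)"
  using assms by (simp add: Bern_def integral_distr algebra_simps)

lemma integrable_Bern_exp: "integrable (Bern r) (\<lambda>y. exp (s * y))"
  unfolding Bern_def
  by (subst integrable_distr_eq) (auto intro!: integrable_measure_pmf_finite)

lemma AE_Bern: "AE y in Bern r. y = 0 \<or> y = 1"
  unfolding Bern_def by (subst AE_distr_iff) auto

section \<open>Entries and row sums of the random matrix\<close>

context binary_symmetric_sbm
begin

lemma label_product: "i \<in> {1..n} \<Longrightarrow> j \<in> {1..n} \<Longrightarrow> xs i * xs j = 1 \<or> xs i * xs j = -1"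
  using balanced_labelsD(2)[OF label, of i] balanced_labelsD(2)[OF label, of j] by auto

lemma entry_distr:
  assumes "1 \<le> i" "i \<le> j" "j \<le> n"
  shows "distr M borel (\<lambda>\<omega>. A \<omega> i j) = Bern (if xs i * xs j = 1 then p else q)"
  using same[OF assms] different[OF assms] label_product[of i j] assms by auto

text \<open>Laws and independence are given for pairs with \<open>i \<le> j\<close> only, while a
  row meets both sides of the diagonal. Sorting the two indices moves every entry of the row into
  that family.\<close>

lemma entry_min_max:
  "\<omega> \<in> space M \<Longrightarrow> i \<in> {1..n} \<Longrightarrow> j \<in> {1..n} \<Longrightarrow> A \<omega> (min i j) (max i j) = A \<omega> i j"
  using symmetric[of \<omega> i j] by (auto simp: min_def max_def)

lemma random_variable_upper_entry:
  assumes "1 \<le> i" "i \<le> j" "j \<le> n"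
  shows "(\<lambda>\<omega>. A \<omega> i j) \<in> borel_measurable M"
  using indep assms by (auto simp: indep_vars_def)

lemma random_variable_entry:
  assumes "i \<in> {1..n}" "j \<in> {1..n}"
  shows "(\<lambda>\<omega>. A \<omega> i j) \<in> borel_measurable M"
proof -
  have "(\<lambda>\<omega>. A \<omega> (min i j) (max i j)) \<in> borel_measurable M"
    using assms by (intro random_variable_upper_entry) auto
  then show ?thesis
    by (rule measurable_cong[THEN iffD1, rotated]) (simp only: entry_min_max assms)
qed

lemma AE_entry:
  assumes "i \<in> {1..n}" "j \<in> {1..n}"
  shows "AE \<omega> in M. A \<omega> i j = 0 \<or> A \<omega> i j = 1"
proof -
  have "AE y in distr M borel (\<lambda>\<omega>. A \<omega> (min i j) (max i j)). y = 0 \<or> y = 1"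
    by (subst entry_distr) (use assms AE_Bern in auto)
  then have "AE \<omega> in M. A \<omega> (min i j) (max i j) = 0 \<or> A \<omega> (min i j) (max i j) = 1"
    using assms by (subst (asm) AE_distr_iff) (auto intro!: random_variable_upper_entry)
  then show ?thesis
    by (rule AE_mp) (intro AE_I2 impI, simp only: entry_min_max assms)
qed

lemma integrable_exp_entry:
  assumes "1 \<le> i" "i \<le> j" "j \<le> n"
  shows "integrable M (\<lambda>\<omega>. exp (s * A \<omega> i j))"
  using integrable_Bern_exp[of "if xs i * xs j = 1 then p else q" s]
  unfolding entry_distr[OF assms, symmetric]
  by (subst (asm) integrable_distr_eq) (auto intro: random_variable_upper_entry assms)

lemma expectation_exp_entry:
  assumes "1 \<le> i" "i \<le> j" "j \<le> n"
  shows "expectation (\<lambda>\<omega>. exp (s * A \<omega> i j)) = 1 + (if xs i * xs j = 1 then p else q) * (exp s - 1)"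
proof -
  have "expectation (\<lambda>\<omega>. exp (s * A \<omega> i j)) = (\<integral>y. exp (s * y) \<partial>distr M borel (\<lambda>\<omega>. A \<omega> i j))"
    by (subst integral_distr) (auto intro: random_variable_upper_entry assms)
  then show ?thesis
    unfolding entry_distr[OF assms] using p_range q_range by (simp add: Bern_mgf)
qed

text \<open>The entries of one row are independent, so the exponential moment is a product. Each
  factor \<open>1 + z\<close> is bounded by \<open>exp z\<close>, and balance evaluates the sum of
  the exponents.\<close>

lemma row_margin_mgf:
  assumes i: "i \<in> {1..n}"
  defines "S \<equiv> \<lambda>\<omega>. \<Sum>j\<in>{1..n}. xs i * xs j * A \<omega> (min i j) (max i j)"
  shows "integrable M (\<lambda>\<omega>. exp (- l * S \<omega>))" (is ?int)
    and "expectation (\<lambda>\<omega>. exp (- l * S \<omega>))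
      \<le> exp (real n / 2 * (p * (exp (- l) - 1) + q * (exp l - 1)))" (is ?le)
proof -
  define h where "h j = (min i j, max i j)" for j
  define w where "w k = - l * (xs (fst k) * xs (snd k))" for k :: "nat \<times> nat"
  define Y where "Y k \<omega> = exp (w k * A \<omega> (fst k) (snd k))" for k \<omega>
  \<comment> \<open>For fixed \<open>i\<close>, the sorted pair determines \<open>j\<close>; hence
    the row consists of distinct members of the independent family.\<close>
  have inj: "inj_on h {1..n}"
    by (auto simp: inj_on_def h_def min_def max_def split: if_splits)
  have range: "1 \<le> fst k \<and> fst k \<le> snd k \<and> snd k \<le> n" if "k \<in> h ` {1..n}" for k
    using that i by (auto simp: h_def)
  have "indep_vars (\<lambda>_. borel) (\<lambda>(i, j) \<omega>. A \<omega> i j) (h ` {1..n})"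
  proof (rule indep_vars_subset[OF indep], rule subsetI)
    fix k assume "k \<in> h ` {1..n}"
    from range[OF this] show "k \<in> {(i, j). 1 \<le> i \<and> i \<le> j \<and> j \<le> n}"
      by (cases k) simp
  qed
  from indep_vars_compose2[OF this, where Y = "\<lambda>k y. exp (w k * y)" and N = "\<lambda>_. borel"]
  have indep_Y: "indep_vars (\<lambda>_. borel) Y (h ` {1..n})"
    by (simp add: Y_def[abs_def] case_prod_beta)
  have int_Y: "integrable M (Y k)" if "k \<in> h ` {1..n}" for k
    unfolding Y_def using range[OF that] by (intro integrable_exp_entry) auto
  have S: "exp (- l * S \<omega>) = (\<Prod>k\<in>h ` {1..n}. Y k \<omega>)" for \<omega>
  proof -
    have "exp (- l * S \<omega>) = (\<Prod>j\<in>{1..n}. exp (- l * (xs i * xs j * A \<omega> (min i j) (max i j))))"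
      unfolding S_def sum_distrib_left by (rule exp_sum) simp
    also have "\<dots> = (\<Prod>j\<in>{1..n}. Y (h j) \<omega>)"
      by (intro prod.cong) (auto simp: Y_def w_def h_def min_def max_def mult_ac)
    finally show ?thesis by (simp only: prod.reindex[OF inj] o_def)
  qed
  show ?int
    unfolding S using indep_Y int_Y by (intro indep_vars_integrable) auto
  \<comment> \<open>An entry's factor is \<open>1 + u\<close> if the labels agree and
    \<open>1 + v\<close> if they differ. Interpolating linearly in \<open>xs i * xs j\<close> covers
    both cases by one formula.\<close>
  define u v where "u = p * (exp (- l) - 1)" and "v = q * (exp l - 1)"
  have factor: "expectation (Y (h j)) \<le> exp ((u + v) / 2 + (u - v) / 2 * xs i * xs j)"
    if j: "j \<in> {1..n}" for j
  proof -
    have h: "fst (h j) = min i j" "snd (h j) = max i j" by (auto simp: h_def)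
    have comm: "xs (min i j) * xs (max i j) = xs i * xs j"
      by (auto simp: min_def max_def)
    have "expectation (Y (h j)) = 1 + (if xs i * xs j = 1 then p else q) * (exp (- l * (xs i * xs j)) - 1)"
      unfolding Y_def w_def h comm using i j
      by (subst expectation_exp_entry) (auto simp: comm)
    also have "\<dots> = 1 + ((u + v) / 2 + (u - v) / 2 * (xs i * xs j))"
      using label_product[OF i j] unfolding u_def v_def
      by (elim disjE) (simp_all add: add_divide_distrib diff_divide_distrib)
    also have "\<dots> \<le> exp ((u + v) / 2 + (u - v) / 2 * (xs i * xs j))"
      by (rule exp_ge_add_one_self)
    finally show ?thesis by (simp add: mult.assoc)
  qed
  have "expectation (\<lambda>\<omega>. exp (- l * S \<omega>)) = (\<Prod>k\<in>h ` {1..n}. expectation (Y k))"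
    unfolding S using indep_Y int_Y by (intro indep_vars_lebesgue_integral) auto
  also have "\<dots> = (\<Prod>j\<in>{1..n}. expectation (Y (h j)))"
    by (simp only: prod.reindex[OF inj] o_def)
  also have "\<dots> \<le> (\<Prod>j\<in>{1..n}. exp ((u + v) / 2 + (u - v) / 2 * xs i * xs j))"
    by (intro prod_mono conjI factor) (auto simp: Y_def intro: integral_nonneg_AE)
  also have "\<dots> = exp (\<Sum>j\<in>{1..n}. (u + v) / 2 + (u - v) / 2 * xs i * xs j)"
    by (simp add: exp_sum)
  \<comment> \<open>The part linear in \<open>xs j\<close> sums to zero by balance, which replaces
    counting \<open>n / 2\<close> vertices in each class.\<close>
  also have "(\<Sum>j\<in>{1..n}. (u + v) / 2 + (u - v) / 2 * xs i * xs j) = real n / 2 * (u + v)"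
    by (simp only: sum.distrib sum_distrib_left[symmetric] balanced_labelsD(1)[OF label]) simp
  finally show ?le by (simp add: u_def v_def)
qed

lemma prob_row_margin_le:
  assumes i: "i \<in> {1..n}" and l: "l > 0"
  shows "prob {\<omega> \<in> space M. (\<Sum>j\<in>{1..n}. xs i * xs j * A \<omega> i j) \<le> t}
    \<le> exp (l * t + real n / 2 * (p * (exp (- l) - 1) + q * (exp l - 1)))"
proof -
  define S where "S \<omega> = (\<Sum>j\<in>{1..n}. xs i * xs j * A \<omega> (min i j) (max i j))" for \<omega>
  have "S \<omega> = (\<Sum>j\<in>{1..n}. xs i * xs j * A \<omega> i j)" if "\<omega> \<in> space M" for \<omega>
    unfolding S_def by (intro sum.cong refl) (simp only: entry_min_max that i)
  then have "prob {\<omega> \<in> space M. (\<Sum>j\<in>{1..n}. xs i * xs j * A \<omega> i j) \<le> t}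
      = prob {\<omega> \<in> space M. S \<omega> \<le> t}"
    by (intro arg_cong[where f = prob] Collect_cong conj_cong refl) simp
  also have "\<dots> \<le> exp (l * t) * (LINT \<omega>:space M|M. exp (- l * S \<omega>))"
    using row_margin_mgf(1)[OF i, of l] unfolding S_def
    by (intro Chernoff_ineq_le l) (simp_all only: set_integrable_def integrable_mult_indicator sets.top)
  also have "(LINT \<omega>:space M|M. exp (- l * S \<omega>)) = expectation (\<lambda>\<omega>. exp (- l * S \<omega>))"
    using row_margin_mgf(1)[OF i, of l] by (subst set_integral_space) (auto simp: S_def)
  also have "exp (l * t) * \<dots> \<le>
      exp (l * t) * exp (real n / 2 * (p * (exp (- l) - 1) + q * (exp l - 1)))"
    unfolding S_def by (intro mult_left_mono row_margin_mgf(2)[OF i]) auto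
  finally show ?thesis by (simp add: exp_add)
qed

section \<open>Probability of the recovery event\<close>

lemma sets_exact_recovery:
  "{\<omega> \<in> space M. \<forall>x\<in>balanced_labels n. dist2 n x xs \<le> r \<longrightarrow>
      proj_labels n (mat_vec n (A \<omega>) x) = {xs}} \<in> sets M"
proof -
  have [measurable]: "(\<lambda>\<omega>. (dist2 n u (mat_vec n (A \<omega>) x))\<^sup>2) \<in> borel_measurable M" for u x
  proof -
    have "(\<lambda>\<omega>. mat_vec n (A \<omega>) x i) \<in> borel_measurable M" if "i \<in> {1..n}" for i
      using that by (auto simp: mat_vec_def
          intro!: borel_measurable_sum borel_measurable_times random_variable_entry)
    then show ?thesis unfolding dist2_squared
      by (intro borel_measurable_sum borel_measurable_power borel_measurable_diff) auto
  qed
  \<comment> \<open>Countability turns both quantifiers over labels into countable intersections of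
    measurable events.\<close>
  have [measurable]: "countable (balanced_labels n)" "countable (balanced_labels n - {xs})"
    by (auto intro!: countable_finite finite_balanced_labels)
  show ?thesis
    unfolding proj_labels_eq_singleton_iff[OF label] by measurable
qed

text \<open>Failure forces some row margin to be at most \<open>t\<close>, up to a null set; the
  factor \<open>real n\<close> comes from the union bound over rows.\<close>

lemma prob_exact_recovery_ge:
  assumes t: "0 \<le> t" and l: "l > 0"
  shows "prob {\<omega> \<in> space M. \<forall>x\<in>balanced_labels n. dist2 n x xs \<le> sqrt (2 * t) \<longrightarrow>
      proj_labels n (mat_vec n (A \<omega>) x) = {xs}}
    \<ge> 1 - real n * exp (l * t + real n / 2 * (p * (exp (- l) - 1) + q * (exp l - 1)))"
    (is "prob ?G \<ge> 1 - real n * ?b")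
proof -
  define B where "B i = {\<omega> \<in> space M. (\<Sum>j\<in>{1..n}. xs i * xs j * A \<omega> i j) \<le> t}" for i
  have B: "B i \<in> events" if "i \<in> {1..n}" for i
  proof -
    have "(\<lambda>\<omega>. \<Sum>j\<in>{1..n}. xs i * xs j * A \<omega> i j) \<in> borel_measurable M"
      using that by (intro borel_measurable_sum borel_measurable_times random_variable_entry) auto
    then show ?thesis unfolding B_def by measurable
  qed
  \<comment> \<open>The entries are 0 or 1 only almost surely, so the failure event lies in the
    union of the \<open>B i\<close> only up to a null set.\<close>
  have "AE \<omega> in M. \<forall>i\<in>{1..n}. \<forall>j\<in>{1..n}. A \<omega> i j = 0 \<or> A \<omega> i j = 1"
    by (intro AE_finite_allI AE_entry) auto
  then have "AE \<omega> in M. \<omega> \<in> space M - ?G \<longrightarrow> \<omega> \<in> (\<Union>i\<in>{1..n}. B i)"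
  proof (rule AE_mp, intro AE_I2 impI)
    fix \<omega> assume \<omega>: "\<omega> \<in> space M" and 01: "\<forall>i\<in>{1..n}. \<forall>j\<in>{1..n}. A \<omega> i j = 0 \<or> A \<omega> i j = 1"
      and bad: "\<omega> \<in> space M - ?G"
    show "\<omega> \<in> (\<Union>i\<in>{1..n}. B i)"
    proof (rule ccontr)
      assume "\<omega> \<notin> (\<Union>i\<in>{1..n}. B i)"
      then have "t < (\<Sum>j\<in>{1..n}. xs i * xs j * A \<omega> i j)" if "i \<in> {1..n}" for i
        using that \<omega> unfolding B_def by force
      then have "proj_labels n (mat_vec n (A \<omega>) x) = {xs}"
        if "x \<in> balanced_labels n" "dist2 n x xs \<le> sqrt (2 * t)" for x
        using that 01
        by (intro proj_labels_eq_singletonI label mat_vec_sign_robust[OF label _ t]) blast+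
      with \<omega> have "\<omega> \<in> ?G" by blast
      with bad show False by blast
    qed
  qed
  then have "prob (space M - ?G) \<le> prob (\<Union>i\<in>{1..n}. B i)"
    using B by (intro finite_measure_mono_AE) auto
  also have "\<dots> \<le> (\<Sum>i\<in>{1..n}. prob (B i))"
    using B by (intro finite_measure_subadditive_finite) auto
  also have "\<dots> \<le> (\<Sum>i\<in>{1..n}. ?b)"
    unfolding B_def by (intro sum_mono prob_row_margin_le l)
  finally show ?thesis
    using prob_compl[OF sets_exact_recovery[of "sqrt (2 * t)"]] by simp
qed

end

section \<open>Choice of the Chernoff parameter and the final exponent\<close>

theorem proposition5:
  fixes \<alpha> \<beta> \<gamma> :: real
  assumes "\<alpha> > \<beta>" and "\<beta> > 0"
    and "sqrt \<alpha> - sqrt \<beta> > sqrt 2"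
    and "\<gamma> > 0"
    and "(sqrt \<alpha> - sqrt \<beta>)\<^sup>2 / 2 - \<gamma> * (ln \<alpha> - ln \<beta>) / 2 - 1 > 0"
  shows "\<exists>c>0. \<exists>N. \<forall>n\<ge>N. \<forall>xs (M :: 'w measure) A.
    binary_symmetric_sbm M n (\<alpha> * ln (real n) / real n) (\<beta> * ln (real n) / real n) xs A \<longrightarrow>
    measure M {\<omega> \<in> space M. \<forall>x \<in> balanced_labels n.
        dist2 n x xs \<le> sqrt (2 * \<gamma> * ln (real n)) \<longrightarrow>
        proj_labels n (mat_vec n (A \<omega>) x) = {xs}}
      \<ge> 1 - real n powr (- c)"
proof -
  define c where "c = (sqrt \<alpha> - sqrt \<beta>)\<^sup>2 / 2 - \<gamma> * (ln \<alpha> - ln \<beta>) / 2 - 1"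
  \<comment> \<open>This \<open>l\<close> minimizes
    \<open>\<alpha> * exp (- l) + \<beta> * exp l\<close>, with minimum
    \<open>2 * sqrt \<alpha> * sqrt \<beta>\<close>; this makes the square in \<open>rate\<close>
    appear.\<close>
  define l where "l = ln (sqrt \<alpha> / sqrt \<beta>)"
  have pos: "\<alpha> > 0" "\<beta> > 0" using assms by auto
  have l: "l > 0" "l = (ln \<alpha> - ln \<beta>) / 2"
    using assms pos by (auto simp: l_def ln_div ln_sqrt)
  have exp_l: "exp l = sqrt \<alpha> / sqrt \<beta>" "exp (- l) = sqrt \<beta> / sqrt \<alpha>"
    using pos by (auto simp: l_def exp_minus)
  have rate: "\<alpha> * (exp (- l) - 1) + \<beta> * (exp l - 1) = - (sqrt \<alpha> - sqrt \<beta>)\<^sup>2"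
  proof -
    have "sqrt \<alpha> * sqrt \<alpha> * (sqrt \<beta> / sqrt \<alpha>) = sqrt \<alpha> * sqrt \<beta>"
         "sqrt \<beta> * sqrt \<beta> * (sqrt \<alpha> / sqrt \<beta>) = sqrt \<alpha> * sqrt \<beta>"
      using pos by (simp_all del: real_sqrt_mult_self)
    with pos show ?thesis
      unfolding exp_l by (simp add: power2_eq_square algebra_simps)
  qed
  have "measure M {\<omega> \<in> space M. \<forall>x \<in> balanced_labels n.
        dist2 n x xs \<le> sqrt (2 * \<gamma> * ln (real n)) \<longrightarrow>
        proj_labels n (mat_vec n (A \<omega>) x) = {xs}} \<ge> 1 - real n powr (- c)"
    if sbm: "binary_symmetric_sbm M n (\<alpha> * ln (real n) / real n) (\<beta> * ln (real n) / real n) xs A"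
    for n xs A and M :: "'w measure"
  proof -
    interpret binary_symmetric_sbm M n "\<alpha> * ln (real n) / real n" "\<beta> * ln (real n) / real n" xs A
      by (rule sbm)
    have n: "real n > 0" "ln (real n) \<ge> 0" using n_ge_2 by auto
    have "l * (\<gamma> * ln n) + real n / 2 * (\<alpha> * ln n / n * (exp (- l) - 1) + \<beta> * ln n / n * (exp l - 1))
        = l * (\<gamma> * ln n) + ln n / 2 * (\<alpha> * (exp (- l) - 1) + \<beta> * (exp l - 1))"
      using n by (simp add: field_simps)
    \<comment> \<open>The summand 1 in \<open>1 + c\<close> absorbs the factor \<open>n\<close> of
      the union bound and leaves \<open>n powr (- c)\<close>.\<close>
    also have "\<dots> = - (1 + c) * ln n"
      unfolding rate by (simp add: l(2) c_def field_simps)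
    finally have "real n * exp (l * (\<gamma> * ln n) +
        real n / 2 * (\<alpha> * ln n / n * (exp (- l) - 1) + \<beta> * ln n / n * (exp l - 1)))
        = real n * real n powr (- (1 + c))"
      using n by (simp add: powr_def)
    also have "\<dots> = real n powr (- c)"
      using n powr_add[of "real n" 1 "- (1 + c)"] by simp
    finally show ?thesis
      using prob_exact_recovery_ge[of "\<gamma> * ln n" l] l(1) n assms(4) by (simp add: mult.assoc)
  qed
  \<comment> \<open>The bound holds for every \<open>n\<close> that admits such a model, so any
    \<open>N\<close> is a witness.\<close>
  then show ?thesis
    using assms(5) unfolding c_def[symmetric] by (intro exI[of _ c]) blast
qed

end
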